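(* For all integers $n\geq 0$ and $\alpha\geq 0$, $$\overline{OPT}(2^\alpha(8n+5))\equiv 0 \pmod 8.$$
   Context: An overpartition of a nonnegative integer $n$ is a non-increasing sequence of positive integers with sum $n$ in which the first occurrence of each number may be overlined. An overpartition triple of $n$ with odd parts is an (ordered) triple $(\xi_1,\xi_2,\xi_3)$ of overpartitions, all of whose parts are odd, such that the sum of all the parts of $\xi_1,\xi_2,\xi_3$ is $n$. $\overline{OPT}(n)$ denotes the number of overpartition triples of $n$ with odd parts. Its generating function is $$\sum_{n\geq 0}\overline{OPT}(n)q^n=\frac{f_2^9}{f_1^6f_4^3}=\prod_{i\geq 0}\left(\frac{1+q^{2i+1}}{1-q^{2i+1}}\right)^3,\qquad f_k:=\prod_{i\geq 1}(1-q^{ki}).$$ *)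

theory Defs
  imports "HOL-Number_Theory.Cong"
begin

text \<open>
  A part is a pair of its size and a flag recording whether it is overlined. In a
  non-increasing list, equal sizes are adjacent, and only the leftmost of them
  (the first occurrence of that size) may carry the flag.
\<close>

type_synonym part = "nat \<times> bool"

definition overpartition :: "part list \<Rightarrow> bool" where
  "overpartition xs \<longleftrightarrow>
     sorted_wrt (\<ge>) (map fst xs) \<and>
     (\<forall>p\<in>set xs. 0 < fst p) \<and>
     (\<forall>i<length xs. snd (xs ! i) \<longrightarrow> (\<forall>j<i. fst (xs ! j) \<noteq> fst (xs ! i)))"

definition odd_parts :: "part list \<Rightarrow> bool" where
  "odd_parts xs \<longleftrightarrow> (\<forall>p\<in>set xs. odd (fst p))"

definition weight :: "part list \<Rightarrow> nat" where
  "weight xs = sum_list (map fst xs)"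

definition odd_overpartition_triples :: "nat \<Rightarrow> (part list \<times> part list \<times> part list) set" where
  "odd_overpartition_triples n =
     {(x, y, z).
        (overpartition x \<and> odd_parts x) \<and>
        (overpartition y \<and> odd_parts y) \<and>
        (overpartition z \<and> odd_parts z) \<and>
        weight x + weight y + weight z = n}"

definition OPT :: "nat \<Rightarrow> nat" where
  "OPT n = card (odd_overpartition_triples n)"

text \<open>The set counted by \<^const>\<open>OPT\<close> is finite, so its cardinality is the actual count.\<close>

lemma finite_overpartitions_le: "finite {xs. overpartition xs \<and> weight xs \<le> n}"
proof (rule finite_subset)
  show "finite {xs. set xs \<subseteq> {..n} \<times> (UNIV :: bool set) \<and> length xs \<le> n}"
    by (rule finite_lists_length_le) simp
  have len: "length xs \<le> weight xs" if "\<forall>p\<in>set xs. 0 < fst p" for xs :: "part list"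
    using that by (induction xs) (auto simp: weight_def)
  have part: "fst p \<le> weight xs" if "p \<in> set xs" for p and xs :: "part list"
    using that by (auto simp: weight_def intro: member_le_sum_list)
  show "{xs. overpartition xs \<and> weight xs \<le> n}
      \<subseteq> {xs. set xs \<subseteq> {..n} \<times> UNIV \<and> length xs \<le> n}"
  proof safe
    fix xs a b
    assume "weight xs \<le> n" "(a, b) \<in> set xs"
    then show "a \<le> n" using part[of "(a, b)" xs] by simp
  next
    fix xs
    assume "overpartition xs" "weight xs \<le> n"
    then show "length xs \<le> n" using len[of xs] by (simp add: overpartition_def)
  qed simp
qed

lemma finite_odd_overpartition_triples: "finite (odd_overpartition_triples n)"
proof (rule finite_subset)
  let ?A = "{xs. overpartition xs \<and> weight xs \<le> n}"
  show "finite (?A \<times> ?A \<times> ?A)"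
    by (intro finite_cartesian_product finite_overpartitions_le)
  show "odd_overpartition_triples n \<subseteq> ?A \<times> ?A \<times> ?A"
    by (auto simp: odd_overpartition_triples_def)
qed

end

theory Submission
  imports Defs "HOL-Computational_Algebra.Formal_Power_Series"
begin

text \<open>
  The generating function is \<open>C ^ 3\<close>, where \<open>C\<close> is the product of the factors
  \<open>(1 + q ^ i) / (1 - q ^ i) = 1 + 2 * G i\<close> over odd \<open>i\<close>, with \<open>G i = q ^ i / (1 - q ^ i)\<close>.
  Writing \<open>D\<close> and \<open>E\<close> for the sums of \<open>G i\<close> and of \<open>(G i)\<^sup>2\<close>, expanding the product gives
  \<open>C ^ 3 = 1 + 6 * D + 2 * D\<^sup>2 + 2 * E\<close> modulo 8. The coefficients of \<open>D\<close> count odd divisors and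
  those of \<open>E\<close> are sums over odd divisors, so for \<open>N = 2 ^ \<alpha> * m\<close>, \<open>m = 8 * n + 5\<close>, only the
  coefficient of \<open>D\<^sup>2\<close> modulo 4 is not immediate. The number of odd divisors of \<open>k\<close> is odd iff \<open>k\<close>
  is a square or twice a square, so that coefficient counts the \<open>k\<close> for which both \<open>k\<close> and
  \<open>N - k\<close> have this form. For \<open>\<alpha> > 0\<close> this count is divisible by 4. For \<open>\<alpha> = 0\<close> it is
  twice the number of solutions of \<open>x\<^sup>2 + (2 * y)\<^sup>2 = m\<close>, and Zagier's involution on the
  solutions of \<open>x\<^sup>2 + 4 * y * z = m\<close> shows that this number has the parity of half the number
  of divisors of \<open>m\<close>.
\<close>

unbundle fps_syntax

section \<open>The generating function modulo 8\<close>

definition bounded_ovs :: "nat \<Rightarrow> nat \<Rightarrow> part list set" where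
  "bounded_ovs K n =
     {xs. overpartition xs \<and> odd_parts xs \<and> (\<forall>p\<in>set xs. fst p \<le> K) \<and> weight xs = n}"

text \<open>Halfway stage between the bounds \<open>K - 1\<close> and \<open>K\<close>: for odd
  \<open>K\<close> it contributes the factor \<open>1 / (1 - q ^ K)\<close>, and an overlined copy
  of \<open>K\<close> supplies \<open>1 + q ^ K\<close> afterwards.\<close>

definition plain_ovs :: "nat \<Rightarrow> nat \<Rightarrow> part list set" where
  "plain_ovs K n = {xs \<in> bounded_ovs K n. (K, True) \<notin> set xs}"

lemma finite_bounded_ovs: "finite (bounded_ovs K n)"
  by (rule finite_subset[OF _ finite_overpartitions_le[of n]]) (auto simp: bounded_ovs_def)

lemma finite_plain_ovs: "finite (plain_ovs K n)"
  by (simp add: plain_ovs_def finite_bounded_ovs)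

lemma overpartition_Cons:
  "overpartition (p # xs) \<longleftrightarrow>
     0 < fst p \<and> (\<forall>q\<in>set xs. fst q \<le> fst p \<and> (snd q \<longrightarrow> fst q \<noteq> fst p)) \<and> overpartition xs"
proof -
  have "(\<forall>i<length (p # xs). snd ((p # xs) ! i) \<longrightarrow>
           (\<forall>j<i. fst ((p # xs) ! j) \<noteq> fst ((p # xs) ! i))) \<longleftrightarrow>
        (\<forall>q\<in>set xs. snd q \<longrightarrow> fst q \<noteq> fst p) \<and>
        (\<forall>i<length xs. snd (xs ! i) \<longrightarrow> (\<forall>j<i. fst (xs ! j) \<noteq> fst (xs ! i)))"
    by (simp add: All_less_Suc2 all_set_conv_all_nth) metis
  then show ?thesis
    unfolding overpartition_def by auto
qed

lemma plain_ovs_eq: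
  assumes "odd K"
  shows "plain_ovs K n = bounded_ovs (K - 1) n \<union>
           (if K \<le> n then Cons (K, False) ` plain_ovs K (n - K) else {})"
proof (intro equalityI subsetI)
  fix xs assume xs: "xs \<in> plain_ovs K n"
  show "xs \<in> bounded_ovs (K - 1) n \<union>
           (if K \<le> n then Cons (K, False) ` plain_ovs K (n - K) else {})"
  proof (cases "\<exists>ys. xs = (K, False) # ys")
    case True
    with xs show ?thesis
      by (auto simp: plain_ovs_def bounded_ovs_def overpartition_Cons odd_parts_def weight_def)
  next
    case False
    have "fst p \<noteq> K" if "p \<in> set xs" for p
      using xs False that
      by (cases xs)
        (fastforce simp: plain_ovs_def bounded_ovs_def overpartition_Cons)+
    then have "xs \<in> bounded_ovs (K - 1) n"
      using xs by (fastforce simp: plain_ovs_def bounded_ovs_def)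
    then show ?thesis by simp
  qed
next
  fix xs assume xs: "xs \<in> bounded_ovs (K - 1) n \<union>
           (if K \<le> n then Cons (K, False) ` plain_ovs K (n - K) else {})"
  then show "xs \<in> plain_ovs K n"
    using odd_pos[OF assms] assms
    by (fastforce simp: plain_ovs_def bounded_ovs_def overpartition_Cons odd_parts_def weight_def
        split: if_splits)
qed

text \<open>An overlined \<open>K\<close> can only be the head, because \<open>K\<close> is maximal
  and only its first occurrence may be overlined; hence the tail has no overlined
  \<open>K\<close>.\<close>

lemma bounded_ovs_eq:
  assumes "odd K"
  shows "bounded_ovs K n = plain_ovs K n \<union>
           (if K \<le> n then Cons (K, True) ` plain_ovs K (n - K) else {})"
proof (intro equalityI subsetI)
  fix xs assume xs: "xs \<in> bounded_ovs K n"
  show "xs \<in> plain_ovs K n \<union>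
           (if K \<le> n then Cons (K, True) ` plain_ovs K (n - K) else {})"
  proof (cases "(K, True) \<in> set xs")
    case True
    with xs obtain ys where "xs = (K, True) # ys"
      by (cases xs) (fastforce simp: bounded_ovs_def overpartition_Cons)+
    with xs show ?thesis
      by (fastforce simp: plain_ovs_def bounded_ovs_def overpartition_Cons odd_parts_def weight_def)
  next
    case False
    with xs show ?thesis by (simp add: plain_ovs_def)
  qed
next
  fix xs assume xs: "xs \<in> plain_ovs K n \<union>
           (if K \<le> n then Cons (K, True) ` plain_ovs K (n - K) else {})"
  then show "xs \<in> bounded_ovs K n"
    using odd_pos[OF assms] assms
    by (fastforce simp: plain_ovs_def bounded_ovs_def overpartition_Cons odd_parts_def weight_def
        split: if_splits)
qed

lemma card_plain_ovs:
  assumes "odd K"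
  shows "card (plain_ovs K n) =
           card (bounded_ovs (K - 1) n) + (if K \<le> n then card (plain_ovs K (n - K)) else 0)"
proof -
  have "bounded_ovs (K - 1) n \<inter> Cons (K, False) ` plain_ovs K (n - K) = {}"
    using odd_pos[OF assms] by (force simp: bounded_ovs_def)
  then show ?thesis
    by (subst plain_ovs_eq[OF assms])
      (simp add: card_Un_disjoint finite_bounded_ovs finite_plain_ovs card_image)
qed

lemma card_bounded_ovs:
  assumes "odd K"
  shows "card (bounded_ovs K n) =
           card (plain_ovs K n) + (if K \<le> n then card (plain_ovs K (n - K)) else 0)"
proof -
  have "plain_ovs K n \<inter> Cons (K, True) ` plain_ovs K (n - K) = {}"
    by (auto simp: plain_ovs_def)
  then show ?thesis
    by (subst bounded_ovs_eq[OF assms])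
      (simp add: card_Un_disjoint finite_plain_ovs card_image)
qed

section \<open>The generating function as a product over odd part sizes\<close>

definition ov_fps :: "nat \<Rightarrow> int fps" where
  "ov_fps K = Abs_fps (\<lambda>n. int (card (bounded_ovs K n)))"

definition mult_fps :: "nat \<Rightarrow> int fps" where
  "mult_fps k = Abs_fps (\<lambda>n. if 0 < n \<and> k dvd n then 1 else 0)"

text \<open>Geometric series: \<open>mult_fps k\<close> is \<open>q ^ k / (1 - q ^ k)\<close>, with
  the denominator cleared.\<close>

lemma mult_fps_times:
  assumes "0 < k"
  shows "mult_fps k * (1 - fps_X ^ k) = fps_X ^ k"
proof (rule fps_ext)
  fix n
  have "mult_fps k * (1 - fps_X ^ k) = mult_fps k - fps_X ^ k * mult_fps k"
    by (simp add: algebra_simps)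
  moreover have "n = k" if "k dvd n" "k \<le> n" "\<not> k < n" using that by simp
  moreover have "k dvd n - k \<longleftrightarrow> k dvd n" if "k \<le> n"
    using that by (simp add: dvd_minus_self)
  ultimately show "(mult_fps k * (1 - fps_X ^ k)) $ n = (fps_X ^ k) $ n"
    using assms by (auto simp: mult_fps_def fps_X_power_mult_nth dest: dvd_imp_le)
qed

lemma ov_fps_step:
  assumes "odd K"
  shows "ov_fps K = ov_fps (K - 1) * (1 + 2 * mult_fps K)"
proof -
  \<comment> \<open>\<open>e\<close> is \<open>ov_fps (K - 1) / (1 - q ^ K)\<close> and
    \<open>ov_fps K\<close> is \<open>(1 + q ^ K) * e\<close>; the quotient
    \<open>(1 + q ^ K) / (1 - q ^ K)\<close> equals \<open>1 + 2 * mult_fps K\<close>.\<close>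
  define e where "e = Abs_fps (\<lambda>n. int (card (plain_ovs K n)))"
  have e: "e = ov_fps (K - 1) + fps_X ^ K * e"
    by (rule fps_ext) (simp add: e_def ov_fps_def fps_X_power_mult_nth card_plain_ovs[OF assms])
  have c: "ov_fps K = e + fps_X ^ K * e"
    by (rule fps_ext) (simp add: e_def ov_fps_def fps_X_power_mult_nth card_bounded_ovs[OF assms])
  have e': "ov_fps (K - 1) = e - fps_X ^ K * e"
    using e by (metis add_diff_cancel_right')
  have "ov_fps (K - 1) * (1 + 2 * mult_fps K)
          = e * ((1 - fps_X ^ K) + 2 * (mult_fps K * (1 - fps_X ^ K)))"
    unfolding e' by (simp add: algebra_simps)
  also have "\<dots> = e + fps_X ^ K * e"
    unfolding mult_fps_times[OF odd_pos[OF assms]] by (simp add: algebra_simps)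
  finally show ?thesis using c by simp
qed

lemma ov_fps_even:
  assumes "even K"
  shows "ov_fps K = ov_fps (K - 1)"
proof -
  have "bounded_ovs K n = bounded_ovs (K - 1) n" for n
  proof -
    have "x \<le> K \<longleftrightarrow> x \<le> K - 1" if "odd x" for x
      using that assms by (cases "x = K") auto
    then show ?thesis
      unfolding bounded_ovs_def odd_parts_def by (metis (lifting))
  qed
  then show ?thesis by (simp add: ov_fps_def)
qed

lemma ov_fps_0: "ov_fps 0 = 1"
proof (rule fps_ext)
  fix n
  have "bounded_ovs 0 n = (if n = 0 then {[]} else {})"
  proof -
    have "bounded_ovs 0 n \<subseteq> {[]}"
    proof
      fix xs assume "xs \<in> bounded_ovs 0 n"
      then show "xs \<in> {[]}"
        by (cases xs) (auto simp: bounded_ovs_def odd_parts_def)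
    qed
    moreover have "[] \<in> bounded_ovs 0 n \<longleftrightarrow> n = 0"
      by (auto simp: bounded_ovs_def overpartition_def odd_parts_def weight_def)
    ultimately show ?thesis by auto
  qed
  then show "ov_fps 0 $ n = 1 $ n" by (simp add: ov_fps_def)
qed

section \<open>Expansion of the product and of its cube modulo 8\<close>

definition odds :: "nat \<Rightarrow> nat set" where
  "odds K = {i. i \<le> K \<and> odd i}"

lemma finite_odds: "finite (odds K)"
  by (simp add: odds_def)

lemma odds_Suc: "odds (Suc K) = (if even K then insert (Suc K) (odds K) else odds K)"
  by (auto simp: odds_def le_Suc_eq intro: odd_pos)

text \<open>\<open>T\<close> is the second elementary symmetric polynomial of the series
  \<open>mult_fps i\<close>; products of three or more terms \<open>2 * mult_fps i\<close> are
  multiples of 8. Recording the relation of \<open>T\<close> to the power sums lets it be eliminated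
  later without dividing by 2.\<close>

lemma ov_fps_mod_8:
  "\<exists>T X. (\<Sum>i\<in>odds K. mult_fps i)\<^sup>2 = (\<Sum>i\<in>odds K. (mult_fps i)\<^sup>2) + 2 * T \<and>
         ov_fps K = 1 + 2 * (\<Sum>i\<in>odds K. mult_fps i) + 4 * T + 8 * X"
proof (induction K)
  case 0
  have "odds 0 = {}" by (auto simp: odds_def intro: odd_pos)
  then show ?case by (intro exI[of _ 0]) (simp add: ov_fps_0)
next
  case (Suc K)
  show ?case
  proof (cases "even K")
    case True
    define G where "G = mult_fps (Suc K)"
    define D where "D = (\<Sum>i\<in>odds K. mult_fps i)"
    define E where "E = (\<Sum>i\<in>odds K. (mult_fps i)\<^sup>2)"
    from Suc obtain T X where D: "D\<^sup>2 = E + 2 * T" and X: "ov_fps K = 1 + 2 * D + 4 * T + 8 * X"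
      by (auto simp: D_def E_def)
    have "Suc K \<notin> odds K" by (simp add: odds_def)
    then have sums: "(\<Sum>i\<in>odds (Suc K). mult_fps i) = D + G"
      "(\<Sum>i\<in>odds (Suc K). (mult_fps i)\<^sup>2) = E + G\<^sup>2"
      using True by (simp_all add: odds_Suc finite_odds D_def E_def G_def)
    have "(D + G)\<^sup>2 = E + G\<^sup>2 + 2 * (T + D * G)"
      using D by (simp add: power2_eq_square algebra_simps)
    moreover have "ov_fps (Suc K)
        = 1 + 2 * (D + G) + 4 * (T + D * G) + 8 * (X + T * G + 2 * X * G)"
      using True ov_fps_step[of "Suc K"] X by (simp add: G_def[symmetric] algebra_simps)
    ultimately show ?thesis unfolding sums by blast
  next
    case False
    then show ?thesis using Suc ov_fps_even[of "Suc K"] by (simp add: odds_Suc)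
  qed
qed

lemma ov_fps_cube_mod_8:
  "\<exists>Y. ov_fps K ^ 3 = 1 + 6 * (\<Sum>i\<in>odds K. mult_fps i) + 2 * (\<Sum>i\<in>odds K. mult_fps i)\<^sup>2
         + 2 * (\<Sum>i\<in>odds K. (mult_fps i)\<^sup>2) + 8 * Y"
proof -
  define D where "D = (\<Sum>i\<in>odds K. mult_fps i)"
  define E where "E = (\<Sum>i\<in>odds K. (mult_fps i)\<^sup>2)"
  obtain T X where D: "D\<^sup>2 = E + 2 * T" and X: "ov_fps K = 1 + 2 * D + 4 * T + 8 * X"
    using ov_fps_mod_8[of K] by (auto simp: D_def E_def)
  \<comment> \<open>\<open>Q\<close> absorbs the error term, so that beyond
    \<open>1 + 6 * D + 12 * D\<^sup>2 + 12 * Q\<close> every term of the cube has a factor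
    8.\<close>
  define Q where "Q = T + 2 * X"
  have X: "ov_fps K = 1 + 2 * D + 4 * Q" using X by (simp add: Q_def)
  have "ov_fps K ^ 3 = 1 + 6 * D + 12 * D\<^sup>2 + 12 * Q
          + 8 * (6 * D * Q + 6 * Q\<^sup>2 + D ^ 3 + 6 * D\<^sup>2 * Q + 12 * D * Q\<^sup>2 + 8 * Q ^ 3)"
    unfolding X by (simp add: power2_eq_square power3_eq_cube algebra_simps)
  \<comment> \<open>Since \<open>12 * T = 6 * (D\<^sup>2 - E)\<close>, \<open>T\<close> disappears;
    modulo 8 the resulting \<open>18 * D\<^sup>2\<close> and \<open>- 6 * E\<close> become
    \<open>2 * D\<^sup>2\<close> and \<open>2 * E\<close>.\<close>
  also have "12 * Q = 6 * D\<^sup>2 - 6 * E + 24 * X" using D by (simp add: Q_def)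
  finally have "ov_fps K ^ 3 = 1 + 6 * D + 2 * D\<^sup>2 + 2 * E
          + 8 * (6 * D * Q + 6 * Q\<^sup>2 + D ^ 3 + 6 * D\<^sup>2 * Q + 12 * D * Q\<^sup>2 + 8 * Q ^ 3
                 + 3 * X + 2 * D\<^sup>2 - E)"
    by (simp add: algebra_simps)
  then show ?thesis unfolding D_def E_def by blast
qed

text \<open>No part of a triple of total weight \<open>N\<close> exceeds \<open>N\<close>, so
  bounding the parts by \<open>N\<close> loses nothing at this coefficient.\<close>

lemma OPT_eq_ov_fps_cube: "int (OPT N) = (ov_fps N ^ 3) $ N"
proof -
  let ?c = "\<lambda>n. bounded_ovs N n"
  \<comment> \<open>\<open>i\<close> is the weight of the first two components together and
    \<open>j\<close> that of the first, matching the nested convolutions in the coefficient of a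
    cube.\<close>
  have "odd_overpartition_triples N =
      (\<Union>i\<in>{0..N}. \<Union>j\<in>{0..i}. ?c j \<times> ?c (i - j) \<times> ?c (N - i))"
  proof (intro equalityI subsetI)
    fix t assume t: "t \<in> odd_overpartition_triples N"
    obtain x y z where txyz: "t = (x, y, z)" by (cases t)
    have part: "fst p \<le> weight xs" if "p \<in> set xs" for p and xs :: "part list"
      using that by (auto simp: weight_def intro: member_le_sum_list)
    have w: "weight x + weight y + weight z = N"
      using t by (simp add: txyz odd_overpartition_triples_def)
    have "x \<in> ?c (weight x)" "y \<in> ?c (weight y)" "z \<in> ?c (weight z)"
      using t w part[of _ x] part[of _ y] part[of _ z]
      by (force simp: txyz odd_overpartition_triples_def bounded_ovs_def)+
    then show "t \<in> (\<Union>i\<in>{0..N}. \<Union>j\<in>{0..i}. ?c j \<times> ?c (i - j) \<times> ?c (N - i))"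
      using w unfolding txyz
      by (intro UN_I[of "weight x + weight y"] UN_I[of "weight x"]) auto
  next
    fix t assume "t \<in> (\<Union>i\<in>{0..N}. \<Union>j\<in>{0..i}. ?c j \<times> ?c (i - j) \<times> ?c (N - i))"
    then show "t \<in> odd_overpartition_triples N"
      by (auto simp: odd_overpartition_triples_def bounded_ovs_def)
  qed
  then have "OPT N = card (\<Union>i\<in>{0..N}. \<Union>j\<in>{0..i}. ?c j \<times> ?c (i - j) \<times> ?c (N - i))"
    by (simp add: OPT_def)
  also have "\<dots> = (\<Sum>i\<in>{0..N}. card (\<Union>j\<in>{0..i}. ?c j \<times> ?c (i - j) \<times> ?c (N - i)))"
    by (rule card_UN_disjoint)
      (simp_all add: finite_bounded_ovs, auto simp: bounded_ovs_def)
  also have "\<dots> = (\<Sum>i\<in>{0..N}. \<Sum>j\<in>{0..i}. card (?c j \<times> ?c (i - j) \<times> ?c (N - i)))"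
    by (intro sum.cong refl card_UN_disjoint)
      (simp_all add: finite_bounded_ovs, auto simp: bounded_ovs_def)
  finally have "OPT N = \<dots>" .
  moreover have "(ov_fps N ^ 3) $ N
      = (\<Sum>i\<in>{0..N}. (\<Sum>j\<in>{0..i}. ov_fps N $ j * ov_fps N $ (i - j)) * ov_fps N $ (N - i))"
    unfolding power3_eq_cube fps_mult_nth ..
  ultimately show ?thesis
    by (simp add: ov_fps_def card_cartesian_product sum_distrib_right mult.assoc)
qed

section \<open>Coefficients as counts of, and sums over, odd divisors\<close>

definition odd_divisors :: "nat \<Rightarrow> nat set" where
  "odd_divisors n = {d. odd d \<and> d dvd n}"

lemma odd_divisors_eq_odds:
  assumes "0 < n" "n \<le> K"
  shows "odd_divisors n = {i \<in> odds K. i dvd n}"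
  using assms by (auto simp: odd_divisors_def odds_def dest: dvd_imp_le)

lemma sum_mult_fps_nth:
  assumes "n \<le> K"
  shows "(\<Sum>i\<in>odds K. mult_fps i) $ n = (if n = 0 then 0 else int (card (odd_divisors n)))"
  using assms
  by (auto simp: fps_sum_nth mult_fps_def odd_divisors_eq_odds[of n K] finite_odds
      sum.If_cases Int_def)

lemma mult_fps_square_nth:
  assumes "0 < n" "0 < k"
  shows "((mult_fps k)\<^sup>2) $ n = (if k dvd n then int (n div k) - 1 else 0)"
proof -
  have "((mult_fps k)\<^sup>2) $ n
      = (\<Sum>j=0..n. if 0 < j \<and> j < n \<and> k dvd j \<and> k dvd n - j then 1 else 0)"
    unfolding power2_eq_square fps_mult_nth
    by (rule sum.cong) (auto simp: mult_fps_def)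
  also have "\<dots> = int (card {j. 0 < j \<and> j < n \<and> k dvd j \<and> k dvd n - j})"
    by (simp add: sum.If_cases Int_def) (rule arg_cong[where f = card], auto)
  also have "\<dots> = (if k dvd n then int (n div k) - 1 else 0)"
  proof (cases "k dvd n")
    case True
    then obtain m where m: "n = k * m" by blast
    have "{j. 0 < j \<and> j < n \<and> k dvd j \<and> k dvd n - j} = (*) k ` {0<..<m}"
      using assms by (auto simp: m elim!: dvdE simp flip: right_diff_distrib')
    then have "card {j. 0 < j \<and> j < n \<and> k dvd j \<and> k dvd n - j} = m - 1"
      using assms by (simp add: card_image inj_on_def)
    moreover have "0 < m" using assms m by (cases m) auto
    ultimately show ?thesis using assms True by (simp add: m of_nat_diff)
  next
    case False
    have "k dvd n" if "j < n" "k dvd j" "k dvd n - j" for j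
      using that dvd_add[of k j "n - j"] by simp
    with False have "{j. 0 < j \<and> j < n \<and> k dvd j \<and> k dvd n - j} = {}" by blast
    then show ?thesis using False by simp
  qed
  finally show ?thesis .
qed

lemma OPT_mod_8:
  assumes "0 < N"
  shows "[int (OPT N) = 6 * int (card (odd_divisors N))
           + 2 * (\<Sum>k\<in>{0<..<N}. int (card (odd_divisors k)) * int (card (odd_divisors (N - k))))
           + 2 * (\<Sum>d\<in>odd_divisors N. int (N div d) - 1)] (mod 8)"
proof -
  define D where "D = (\<Sum>i\<in>odds N. mult_fps i)"
  obtain Y where Y: "ov_fps N ^ 3 = 1 + 6 * D + 2 * D\<^sup>2 + 2 * (\<Sum>i\<in>odds N. (mult_fps i)\<^sup>2) + 8 * Y"
    using ov_fps_cube_mod_8[of N] by (auto simp: D_def)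
  have D: "D $ n = (if n = 0 then 0 else int (card (odd_divisors n)))" if "n \<le> N" for n
    using that by (simp add: D_def sum_mult_fps_nth)
  have "(D\<^sup>2) $ N = (\<Sum>k\<in>{0..N}. D $ k * D $ (N - k))"
    by (simp add: power2_eq_square fps_mult_nth)
  also have "\<dots> = (\<Sum>k\<in>{0<..<N}. int (card (odd_divisors k)) * int (card (odd_divisors (N - k))))"
    \<comment> \<open>The end terms \<open>k = 0\<close> and \<open>k = N\<close> vanish because
      \<open>D\<close> has no constant term.\<close>
    by (rule sum.mono_neutral_cong_right) (auto simp: D)
  finally have D2: "(D\<^sup>2) $ N = \<dots>" .
  have "(\<Sum>i\<in>odds N. (mult_fps i)\<^sup>2) $ N
      = (\<Sum>i\<in>odds N. if i dvd N then int (N div i) - 1 else 0)"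
    unfolding fps_sum_nth using assms
    by (intro sum.cong refl mult_fps_square_nth) (auto simp: odds_def odd_pos)
  also have "\<dots> = (\<Sum>d\<in>odd_divisors N. int (N div d) - 1)"
    using assms odd_divisors_eq_odds[of N N]
    by (simp add: sum.inter_filter[symmetric] finite_odds)
  finally have E: "(\<Sum>i\<in>odds N. (mult_fps i)\<^sup>2) $ N = \<dots>" .
  have "int (OPT N) = 6 * D $ N + 2 * (D\<^sup>2) $ N + 2 * (\<Sum>i\<in>odds N. (mult_fps i)\<^sup>2) $ N + 8 * Y $ N"
    using assms by (simp add: OPT_eq_ov_fps_cube Y numeral_fps_const)
  then show ?thesis
    using assms by (simp add: D2 E D cong_def)
qed

section \<open>Parity of the number of odd divisors\<close>

text \<open>Points moved by \<open>f\<close> fall into pairs \<open>{x, f x}\<close>; the induction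
  removes one pair at a time.\<close>

lemma even_card_involution:
  assumes "finite S" "\<And>x. x \<in> S \<Longrightarrow> f x \<in> S" "\<And>x. x \<in> S \<Longrightarrow> f (f x) = x"
  shows "even (card S) \<longleftrightarrow> even (card {x \<in> S. f x = x})"
  using assms
proof (induction S rule: finite_psubset_induct)
  case (psubset S)
  show ?case
  proof (cases "\<exists>x\<in>S. f x \<noteq> x")
    case True
    then obtain x where x: "x \<in> S" "f x \<noteq> x" by blast
    define S' where "S' = S - {x, f x}"
    have S: "S = insert x (insert (f x) S')" using x psubset.prems by (auto simp: S'_def)
    have "finite S'" "x \<notin> S'" "f x \<notin> S'" using psubset.hyps by (simp_all add: S'_def)
    then have "card S = card S' + 2" using x by (subst S) simp
    moreover have "{y \<in> S. f y = y} = {y \<in> S'. f y = y}"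
      using x psubset.prems by (auto simp: S'_def)
    moreover have "even (card S') \<longleftrightarrow> even (card {y \<in> S'. f y = y})"
    proof (rule psubset.IH)
      show "S' \<subset> S" using x by (auto simp: S'_def)
      show "f y \<in> S'" if "y \<in> S'" for y
        using that x psubset.prems by (auto simp: S'_def) (metis psubset.prems(2))+
      show "f (f y) = y" if "y \<in> S'" for y
        using that psubset.prems by (auto simp: S'_def)
    qed
    ultimately show ?thesis by simp
  next
    case False
    then have "{x \<in> S. f x = x} = S" by auto
    then show ?thesis by simp
  qed
qed

definition sq_or_twice_sq :: "nat \<Rightarrow> bool" where
  "sq_or_twice_sq k \<longleftrightarrow> (\<exists>x. k = x\<^sup>2 \<or> k = 2 * x\<^sup>2)"

lemma sq_or_twice_sq_square: "sq_or_twice_sq (x\<^sup>2)"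
  by (auto simp: sq_or_twice_sq_def)

text \<open>Doubling exchanges the two forms, as
  \<open>2 * (2 * x\<^sup>2) = (2 * x)\<^sup>2\<close>.\<close>

lemma sq_or_twice_sq_double: "sq_or_twice_sq (2 * k) \<longleftrightarrow> sq_or_twice_sq k"
proof
  assume "sq_or_twice_sq (2 * k)"
  then obtain x where "2 * k = x\<^sup>2 \<or> 2 * k = 2 * x\<^sup>2" by (auto simp: sq_or_twice_sq_def)
  then show "sq_or_twice_sq k"
  proof
    assume x: "2 * k = x\<^sup>2"
    then have "even (x\<^sup>2)" by (metis dvd_triv_left)
    then obtain y where "x = 2 * y" by auto
    with x have "k = 2 * y\<^sup>2" by (simp add: power2_eq_square)
    then show ?thesis by (auto simp: sq_or_twice_sq_def)
  qed (auto simp: sq_or_twice_sq_def)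
next
  assume "sq_or_twice_sq k"
  then obtain x where "k = x\<^sup>2 \<or> k = 2 * x\<^sup>2" by (auto simp: sq_or_twice_sq_def)
  then have "2 * k = 2 * x\<^sup>2 \<or> 2 * k = (2 * x)\<^sup>2" by (auto simp: power2_eq_square)
  then show "sq_or_twice_sq (2 * k)" unfolding sq_or_twice_sq_def by blast
qed

lemma sq_or_twice_sq_odd: "odd k \<Longrightarrow> sq_or_twice_sq k \<longleftrightarrow> (\<exists>x. k = x\<^sup>2)"
  by (auto simp: sq_or_twice_sq_def)

lemma sq_or_twice_sq_oddE:
  assumes "sq_or_twice_sq k" "odd k"
  obtains x where "k = x\<^sup>2" "odd x"
  using assms by (auto simp: sq_or_twice_sq_odd)

lemma odd_divisors_double: "odd_divisors (2 * k) = odd_divisors k"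
  by (auto simp: odd_divisors_def coprime_dvd_mult_right_iff)

lemma odd_divisors_odd: "odd k \<Longrightarrow> odd_divisors k = {d. d dvd k}"
  by (auto simp: odd_divisors_def dest: dvd_trans)

lemma odd_divisors_power2_times: "odd_divisors (2 ^ a * k) = odd_divisors k"
  by (induction a) (simp_all add: odd_divisors_double mult.assoc)

text \<open>The involution sending a divisor \<open>d\<close> to \<open>k div d\<close> fixes only a
  square root of \<open>k\<close>.\<close>

lemma odd_card_divisors:
  assumes "0 < (k :: nat)"
  shows "odd (card {d. d dvd k}) \<longleftrightarrow> (\<exists>x. k = x\<^sup>2)"
proof -
  have "even (card {d. d dvd k}) \<longleftrightarrow> even (card {d \<in> {d. d dvd k}. k div d = d})"
    by (rule even_card_involution) (use assms in \<open>auto simp: div_dvd_iff_mult\<close>)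
  moreover have fixed: "{d \<in> {d. d dvd k}. k div d = d} = {d. k = d\<^sup>2}"
    using assms by (auto simp: power2_eq_square)
  moreover have "{d. k = d\<^sup>2} = {x}" if "k = x\<^sup>2" for x
    using that by (auto simp: power2_eq_iff_nonneg)
  ultimately show ?thesis by (cases "\<exists>x. k = x\<^sup>2") auto
qed

text \<open>Halving an even \<open>k\<close> changes neither side; for odd \<open>k\<close> all
  divisors are odd, which reduces the claim to \<open>odd_card_divisors\<close>.\<close>

lemma odd_card_odd_divisors:
  assumes "0 < k"
  shows "odd (card (odd_divisors k)) \<longleftrightarrow> sq_or_twice_sq k"
  using assms
proof (induction k rule: less_induct)
  case (less k)
  show ?case
  proof (cases "even k")
    case True
    then obtain m where "k = 2 * m" by blast
    then show ?thesis
      using less by (simp add: odd_divisors_double sq_or_twice_sq_double)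
  next
    case False
    then show ?thesis
      using less.prems by (simp add: odd_divisors_odd odd_card_divisors sq_or_twice_sq_odd)
  qed
qed

section \<open>Divisors grouped in pairs \<open>d\<close>, \<open>m div d\<close>\<close>

definition small_divisors :: "nat \<Rightarrow> nat set" where
  "small_divisors m = {d. d dvd m \<and> d * d < m}"

text \<open>For a nonsquare \<open>m\<close> no divisor is its own cofactor, so
  \<open>small_divisors m\<close> picks exactly one member of each pair.\<close>

lemma sum_divisors_pair:
  fixes g :: "nat \<Rightarrow> int"
  assumes "0 < m" "\<And>x. m \<noteq> x\<^sup>2"
  shows "(\<Sum>d | d dvd m. g d) = (\<Sum>d\<in>small_divisors m. g d + g (m div d))"
proof -
  have "{d. d dvd m} = small_divisors m \<union> {d. d dvd m \<and> m < d * d}"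
    using assms(2) by (auto simp: small_divisors_def power2_eq_square) (metis linorder_neqE_nat)
  moreover have "finite {d. d dvd m}" using assms(1) by simp
  ultimately have "(\<Sum>d | d dvd m. g d)
      = (\<Sum>d\<in>small_divisors m. g d) + (\<Sum>d | d dvd m \<and> m < d * d. g d)"
    by (metis (no_types, lifting) sum.union_disjoint finite_Un disjoint_iff mem_Collect_eq
        small_divisors_def less_asym)
  also have "(\<Sum>d | d dvd m \<and> m < d * d. g d) = (\<Sum>d\<in>small_divisors m. g (m div d))"
    by (rule sum.reindex_bij_witness[of _ "\<lambda>d. m div d" "\<lambda>d. m div d"])
      (use assms(1) in \<open>auto simp: small_divisors_def elim!: dvdE\<close>)
  finally show ?thesis by (simp add: sum.distrib)
qed

section \<open>Zagier's involution\<close>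

definition zagier_triples :: "nat \<Rightarrow> (nat \<times> nat \<times> nat) set" where
  "zagier_triples m = {(x, y, z). 0 < x \<and> 0 < y \<and> 0 < z \<and> x\<^sup>2 + 4 * y * z = m}"

text \<open>Each branch condition makes the natural-number subtractions of that branch exact. In the
  equality cases \<open>x + z = y\<close> and \<open>x = 2 * y\<close> an entry of the image would
  be 0.\<close>

definition zagier_map :: "nat \<times> nat \<times> nat \<Rightarrow> nat \<times> nat \<times> nat" where
  "zagier_map = (\<lambda>(x, y, z).
     if x + z < y then (x + 2 * z, z, y - (x + z))
     else if x < 2 * y then (2 * y - x, y, x + z - y)
     else (x - 2 * y, x + z - y, y))"

lemma finite_zagier_triples: "finite (zagier_triples m)"
proof (rule finite_subset)
  show "zagier_triples m \<subseteq> {..m} \<times> {..m} \<times> {..m}"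
  proof
    fix t assume "t \<in> zagier_triples m"
    then obtain x y z where t: "t = (x, y, z)" "0 < x" "0 < y" "0 < z" "x\<^sup>2 + 4 * y * z = m"
      by (auto simp: zagier_triples_def)
    have "x \<le> x * x" "y \<le> y * z" "z \<le> y * z" using t by simp_all
    then have "x \<le> m" "y \<le> m" "z \<le> m"
      using t(5) unfolding power2_eq_square mult.assoc by linarith+
    then show "t \<in> {..m} \<times> {..m} \<times> {..m}" using t(1) by simp
  qed
qed simp

text \<open>The first and third branches undo each other and the second undoes itself. The equality
  cases cannot occur: \<open>x = 2 * y\<close> would make \<open>m\<close> even, and
  \<open>x + z = y\<close> would make \<open>m = (x + 2 * z)\<^sup>2\<close>.\<close>

lemma zagier_map_involution:
  assumes "odd m" "\<And>x. m \<noteq> x\<^sup>2" "t \<in> zagier_triples m"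
  shows "zagier_map t \<in> zagier_triples m \<and> zagier_map (zagier_map t) = t"
proof -
  obtain x y z where t: "t = (x, y, z)" "0 < x" "0 < y" "0 < z" "x\<^sup>2 + 4 * y * z = m"
    using assms(3) by (auto simp: zagier_triples_def)
  have "x \<noteq> 2 * y"
    using t assms(1) by (auto simp: power_mult_distrib)
  moreover have "x + z \<noteq> y"
  proof
    assume "x + z = y"
    then have "m = (x + 2 * z)\<^sup>2" using t by (auto simp: power2_eq_square algebra_simps)
    then show False using assms(2) by blast
  qed
  ultimately consider "x + z < y" | "y < x + z" "x < 2 * y" | "2 * y < x" by linarith
  then show ?thesis
  proof cases
    case 1
    then obtain k where "y = x + z + k" "0 < k" using less_imp_add_positive by blast
    then show ?thesis
      using t by (auto simp: zagier_map_def zagier_triples_def power2_eq_square algebra_simps)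
  next
    case 2
    obtain a where a: "2 * y = x + a" "0 < a" using 2 less_imp_add_positive by metis
    obtain b where b: "x + z = y + b" "0 < b" using 2 less_imp_add_positive by metis
    \<comment> \<open>In the middle branch the invariance of the quadratic form needs cancellation,
      so it is checked over the integers.\<close>
    have ab: "int a = 2 * int y - int x" "int b = int x + int z - int y" using a b by linarith+
    have "int (a\<^sup>2 + 4 * y * b) = (int a)\<^sup>2 + 4 * int y * int b" by simp
    also have "\<dots> = int (x\<^sup>2 + 4 * y * z)"
      unfolding ab by (simp add: power2_eq_square algebra_simps)
    finally have "int (a\<^sup>2 + 4 * y * b) = int (x\<^sup>2 + 4 * y * z)" .
    then have "a\<^sup>2 + 4 * y * b = m" using t by linarith
    moreover have "zagier_map t = (a, y, b)" using 2 a b t by (simp add: zagier_map_def)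
    moreover have "zagier_map (a, y, b) = t"
      using 2 a b t by (auto simp: zagier_map_def)
    ultimately show ?thesis using a b t by (simp add: zagier_triples_def)
  next
    case 3
    then obtain k where "x = 2 * y + k" "0 < k" using less_imp_add_positive by blast
    then show ?thesis
      using t by (auto simp: zagier_map_def zagier_triples_def power2_eq_square algebra_simps)
  qed
qed

definition two_sq_reps :: "nat \<Rightarrow> (nat \<times> nat) set" where
  "two_sq_reps m = {(x, y). 0 < x \<and> 0 < y \<and> x\<^sup>2 + (2 * y)\<^sup>2 = m}"

lemma mod_4_eq_of_mult:
  fixes a b :: nat
  assumes "(a * b) mod 4 = 1"
  shows "a mod 4 = b mod 4" "(a + b) mod 4 = 2"
proof -
  have "(a mod 4) * (b mod 4) mod 4 = 1" using assms by (simp add: mod_mult_eq)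
  moreover have "a mod 4 \<in> {0, 1, 2, 3}" "b mod 4 \<in> {0, 1, 2, 3}" by auto
  ultimately have *: "a mod 4 = 1 \<and> b mod 4 = 1 \<or> a mod 4 = 3 \<and> b mod 4 = 3" by auto
  then show "a mod 4 = b mod 4" by auto
  have "(a + b) mod 4 = (a mod 4 + b mod 4) mod 4" by (simp add: mod_add_eq)
  with * show "(a + b) mod 4 = 2" by auto
qed

text \<open>Two involutions of the same set have fixed-point counts of equal parity. Swapping
  \<open>y\<close> and \<open>z\<close> fixes the triples with \<open>y = z\<close>, which are
  \<open>two_sq_reps m\<close>; \<open>zagier_map\<close> fixes those with \<open>x = y\<close>,
  which are the factorisations \<open>m = x * (x + 4 * z)\<close>.\<close>

lemma even_card_two_sq_reps:
  assumes "m mod 4 = 1" "\<And>x. m \<noteq> x\<^sup>2"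
  shows "even (card (two_sq_reps m)) \<longleftrightarrow> even (card (small_divisors m))"
proof -
  have "odd m" using assms(1) by presburger
  let ?swap = "\<lambda>(x, y, z). (x, z, y) :: nat \<times> nat \<times> nat"
  have "even (card (zagier_triples m)) \<longleftrightarrow> even (card {t \<in> zagier_triples m. ?swap t = t})"
    by (rule even_card_involution[OF finite_zagier_triples])
      (auto simp: zagier_triples_def algebra_simps)
  moreover have "{t \<in> zagier_triples m. ?swap t = t} = (\<lambda>(x, y). (x, y, y)) ` two_sq_reps m"
    by (auto simp: zagier_triples_def two_sq_reps_def power2_eq_square image_iff)
  moreover have "card ((\<lambda>(x, y). (x, y, y)) ` two_sq_reps m) = card (two_sq_reps m)"
    by (rule card_image) (auto simp: inj_on_def)
  moreover have "even (card (zagier_triples m)) \<longleftrightarrow>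
      even (card {t \<in> zagier_triples m. zagier_map t = t})"
    by (rule even_card_involution[OF finite_zagier_triples])
      (use zagier_map_involution[OF \<open>odd m\<close> assms(2)] in blast)+
  moreover have "card {t \<in> zagier_triples m. zagier_map t = t} = card (small_divisors m)"
  proof (rule bij_betw_same_card)
    let ?T = "{t \<in> zagier_triples m. zagier_map t = t}"
    \<comment> \<open>Inverse of \<open>fst\<close>: the cofactor of \<open>d\<close> is
      \<open>d + 4 * z\<close>, which determines \<open>z\<close>.\<close>
    let ?g = "\<lambda>d. (d, d, (m div d - d) div 4)"
    have T: "?T = {(x, y, z). x = y \<and> 0 < x \<and> 0 < z \<and> x * (x + 4 * z) = m}"
      by (auto simp: zagier_triples_def zagier_map_def power2_eq_square algebra_simps
          split: if_splits)
    show "bij_betw fst ?T (small_divisors m)"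
      unfolding T
    proof (rule bij_betw_byWitness[where f' = ?g])
      show "?g ` small_divisors m \<subseteq> {(x, y, z). x = y \<and> 0 < x \<and> 0 < z \<and> x * (x + 4 * z) = m}"
      proof safe
        fix d assume "d \<in> small_divisors m"
        then obtain e where e: "m = d * e" "d * d < d * e" by (auto simp: small_divisors_def)
        then have "0 < d" "d < e" by auto
        moreover have "4 dvd e - d"
          using mod_4_eq_of_mult(1)[of d e] assms(1) e \<open>d < e\<close>
          by (auto simp flip: mod_eq_dvd_iff_nat)
        ultimately show "0 < d" "0 < (m div d - d) div 4"
            "d * (d + 4 * ((m div d - d) div 4)) = m"
          using e by (auto elim!: dvdE)
      qed
    qed (auto simp: small_divisors_def)
  qed
  ultimately show ?thesis by simp
qed

section \<open>Sums of two numbers that are squares or twice squares\<close>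

definition rep_set :: "nat \<Rightarrow> nat set" where
  "rep_set n = {k \<in> {0<..<n}. sq_or_twice_sq k \<and> sq_or_twice_sq (n - k)}"

lemma finite_rep_set: "finite (rep_set n)"
  by (simp add: rep_set_def)

lemma rep_set_flip: "k \<in> rep_set n \<Longrightarrow> n - k \<in> rep_set n"
  by (auto simp: rep_set_def)

lemma odd_square_mod_8:
  fixes x :: nat
  assumes "odd x"
  shows "x\<^sup>2 mod 8 = 1"
proof -
  obtain y where y: "x = 2 * y + 1" using assms by (rule oddE)
  have "even (y * (y + 1))" by simp
  then obtain c where c: "y * (y + 1) = 2 * c" by blast
  have "x\<^sup>2 = 4 * (y * (y + 1)) + 1" by (simp add: y power2_eq_square)
  then have "x\<^sup>2 = 8 * c + 1" by (simp only: c)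
  then show ?thesis by simp
qed

text \<open>If \<open>k\<close> were odd, \<open>k\<close> and \<open>4 * m - k\<close> would be odd
  squares with sum 2 modulo 8, which is no multiple of 4. So both are even and can be
  halved.\<close>

lemma card_rep_set_4: "card (rep_set (4 * m)) = card (rep_set (2 * m))"
proof -
  have "rep_set (4 * m) = (*) 2 ` rep_set (2 * m)"
  proof (intro equalityI subsetI)
    fix k assume k: "k \<in> rep_set (4 * m)"
    have "even k"
    proof (rule ccontr)
      assume "odd k"
      moreover have "odd (4 * m - k)" using \<open>odd k\<close> k by (auto simp: rep_set_def)
      moreover have "sq_or_twice_sq k" "sq_or_twice_sq (4 * m - k)" "k < 4 * m"
        using k by (simp_all add: rep_set_def)
      ultimately obtain x y where "k = x\<^sup>2" "odd x" "4 * m - k = y\<^sup>2" "odd y"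
        by (meson sq_or_twice_sq_oddE)
      then have "k mod 8 = 1" "(4 * m - k) mod 8 = 1"
        by (simp_all add: odd_square_mod_8)
      then obtain a b where ab: "k = 8 * a + 1" "4 * m - k = 8 * b + 1"
        by (metis mult_div_mod_eq)
      have "4 * m = (4 * m - k) + k" using \<open>k < 4 * m\<close> by simp
      also have "\<dots> = 8 * (a + b) + 2" unfolding ab(2) by (simp add: ab(1))
      finally have "4 * m = 8 * (a + b) + 2" .
      then show False by presburger
    qed
    then obtain j where j: "k = 2 * j" by blast
    then have "4 * m - k = 2 * (2 * m - j)" by simp
    then have "j \<in> rep_set (2 * m)"
      using k j by (simp add: rep_set_def sq_or_twice_sq_double)
    then show "k \<in> (*) 2 ` rep_set (2 * m)" using j by blast
  next
    fix k assume "k \<in> (*) 2 ` rep_set (2 * m)"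
    then obtain j where j: "k = 2 * j" "j \<in> rep_set (2 * m)" by blast
    then have "4 * m - k = 2 * (2 * m - j)" by simp
    then show "k \<in> rep_set (4 * m)"
      using j by (simp add: rep_set_def sq_or_twice_sq_double)
  qed
  then show ?thesis by (simp add: card_image inj_on_def)
qed

text \<open>Exactly one of \<open>k\<close> and \<open>m - k\<close> is odd. It is an odd square,
  hence 1 modulo 8, so the other is 4 modulo 8, which forces it to be an even square.\<close>

lemma card_rep_set_odd:
  assumes "m mod 8 = 5"
  shows "card (rep_set m) = 2 * card (two_sq_reps m)"
proof -
  have "odd m" using assms by presburger
  let ?B = "{k \<in> rep_set m. odd k}"
  have "rep_set m = ?B \<union> (\<lambda>k. m - k) ` ?B"
  proof (intro equalityI subsetI)
    fix k assume k: "k \<in> rep_set m"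
    show "k \<in> ?B \<union> (\<lambda>k. m - k) ` ?B"
    proof (cases "odd k")
      case False
      have "k < m" using k by (simp add: rep_set_def)
      then have "m - k \<in> ?B" "k = m - (m - k)"
        using False \<open>odd m\<close> k rep_set_flip by auto
      then show ?thesis by blast
    qed (use k in simp)
  qed (auto intro: rep_set_flip)
  moreover have "?B \<inter> (\<lambda>k. m - k) ` ?B = {}"
    using \<open>odd m\<close> by (auto simp: rep_set_def)
  moreover have "card ((\<lambda>k. m - k) ` ?B) = card ?B"
    by (rule card_image) (auto simp: inj_on_def rep_set_def)
  ultimately have "card (rep_set m) = 2 * card ?B"
    by (metis (no_types, lifting) card_Un_disjoint finite_rep_set finite_Un mult_2)
  moreover have "?B = (\<lambda>(x, y). x\<^sup>2) ` two_sq_reps m"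
  proof (intro equalityI subsetI)
    fix k assume k: "k \<in> ?B"
    then obtain x where x: "k = x\<^sup>2" "odd x" by (auto simp: rep_set_def sq_or_twice_sq_odd)
    have "k < m" "0 < k" using k by (simp_all add: rep_set_def)
    have "k mod 8 = 1" using x odd_square_mod_8 by blast
    then have "m - k = 8 * (m div 8 - k div 8) + 4"
      using assms \<open>k < m\<close> mult_div_mod_eq[of 8 m] mult_div_mod_eq[of 8 k] by linarith
    then have *: "(m - k) mod 8 = 4" by simp
    obtain w where "m - k = w\<^sup>2 \<or> m - k = 2 * w\<^sup>2"
      using k by (auto simp: rep_set_def sq_or_twice_sq_def)
    then have "m - k = w\<^sup>2 \<and> even w"
    proof
      assume w: "m - k = w\<^sup>2"
      then have "even w" using * odd_square_mod_8[of w] by auto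
      with w show ?thesis by simp
    next
      assume w: "m - k = 2 * w\<^sup>2"
      \<comment> \<open>Twice a square can be 4 modulo 8 only if the square is 2 modulo 4, which is
        impossible.\<close>
      then have "w\<^sup>2 mod 4 = 2" using * mod_mult_mult1[of 2 "w\<^sup>2" 4] by simp
      moreover have "w\<^sup>2 mod 4 = 0" if "even w" using that by (auto simp: power_mult_distrib)
      moreover have "w\<^sup>2 mod 4 \<noteq> 2" if "odd w"
      proof -
        have "odd (w\<^sup>2)" using that by simp
        then show ?thesis by presburger
      qed
      ultimately show ?thesis by (cases "even w") simp_all
    qed
    then obtain y where "m - k = (2 * y)\<^sup>2" by blast
    then have "(x, y) \<in> two_sq_reps m"
      using x \<open>k < m\<close> \<open>0 < k\<close> by (auto simp: two_sq_reps_def intro!: Nat.gr0I)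
    then show "k \<in> (\<lambda>(x, y). x\<^sup>2) ` two_sq_reps m" using x by force
  next
    fix k assume "k \<in> (\<lambda>(x, y). x\<^sup>2) ` two_sq_reps m"
    then obtain x y where xy: "k = x\<^sup>2" "0 < x" "0 < y" "x\<^sup>2 + (2 * y)\<^sup>2 = m"
      by (auto simp: two_sq_reps_def)
    then have "m - k = (2 * y)\<^sup>2" by simp
    moreover have "odd k" using xy \<open>odd m\<close> by auto
    moreover have "0 < k" "k < m" using xy by auto
    ultimately show "k \<in> ?B"
      using xy(1) sq_or_twice_sq_square[of x] sq_or_twice_sq_square[of "2 * y"]
      by (simp add: rep_set_def)
  qed
  moreover have "inj_on (\<lambda>(x, y). x\<^sup>2) (two_sq_reps m)"
    by (auto simp: inj_on_def two_sq_reps_def)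
  ultimately show ?thesis by (simp add: card_image)
qed

text \<open>Here \<open>k = a\<^sup>2\<close> and \<open>2 * m - k = b\<^sup>2\<close> with
  \<open>a\<close>, \<open>b\<close> odd. Half sum and half difference of \<open>a\<close> and
  \<open>b\<close> turn this into a representation of \<open>m\<close> as a sum of two squares;
  conversely \<open>(x, y)\<close> gives \<open>k = (x - 2 * y)\<^sup>2 = m - 4 * x * y\<close>. The
  factor 2 comes from exchanging \<open>k\<close> with \<open>2 * m - k\<close>.\<close>

lemma card_odd_rep_set_double:
  assumes "odd m" "\<And>x. m \<noteq> x\<^sup>2"
  shows "card {k \<in> rep_set (2 * m). odd k} = 2 * card (two_sq_reps m)"
proof -
  let ?O = "{k \<in> rep_set (2 * m). odd k}"
  let ?B = "{k \<in> ?O. k < m}"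
  have flip: "2 * m - k \<in> ?O" if "k \<in> ?O" for k
    using that rep_set_flip by (auto simp: rep_set_def)
  \<comment> \<open>The exchange of \<open>k\<close> with \<open>2 * m - k\<close> has no fixed
    point among the odd \<open>k\<close>, as \<open>m\<close> is not a square.\<close>
  have "m \<notin> ?O" using assms by (auto simp: rep_set_def sq_or_twice_sq_odd)
  have "?O = ?B \<union> (\<lambda>k. 2 * m - k) ` ?B"
  proof (intro equalityI subsetI)
    fix k assume k: "k \<in> ?O"
    show "k \<in> ?B \<union> (\<lambda>k. 2 * m - k) ` ?B"
    proof (cases "k < m")
      case False
      have "k < 2 * m" using k by (simp add: rep_set_def)
      moreover have "k \<noteq> m" using k \<open>m \<notin> ?O\<close> by blast
      ultimately have "2 * m - k \<in> ?B" "k = 2 * m - (2 * m - k)"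
        using False flip[OF k] by auto
      then show ?thesis by blast
    qed (use k in simp)
  qed (use flip in blast)
  moreover have "?B \<inter> (\<lambda>k. 2 * m - k) ` ?B = {}"
    by auto
  moreover have "card ((\<lambda>k. 2 * m - k) ` ?B) = card ?B"
    by (rule card_image) (auto simp: inj_on_def rep_set_def)
  moreover have "finite ?B" by (simp add: finite_rep_set)
  ultimately have "card ?O = 2 * card ?B"
    by (metis (no_types, lifting) card_Un_disjoint finite_imageI mult_2)
  moreover have "?B = (\<lambda>(x, y). m - 4 * x * y) ` two_sq_reps m"
  proof (intro equalityI subsetI)
    fix k assume k: "k \<in> ?B"
    then have "sq_or_twice_sq k" "odd k" by (simp_all add: rep_set_def)
    then obtain a where a: "k = a\<^sup>2" "odd a" by (rule sq_or_twice_sq_oddE)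
    have "2 * m - k \<in> ?O" using k flip by blast
    then have "sq_or_twice_sq (2 * m - k)" "odd (2 * m - k)" by (simp_all add: rep_set_def)
    then obtain b where b: "2 * m - k = b\<^sup>2" "odd b" by (rule sq_or_twice_sq_oddE)
    have "k < m" using k by simp
    then have ab: "a\<^sup>2 + b\<^sup>2 = 2 * m" "a\<^sup>2 < b\<^sup>2" using a b by linarith+
    then have "a < b" using power2_less_imp_less by blast
    \<comment> \<open>\<open>v\<close> is the half difference and \<open>u\<close> the half sum of
      \<open>a\<close> and \<open>b\<close>. As \<open>a = u - v\<close> is odd, exactly one of them
      is even and serves as \<open>2 * y\<close>.\<close>
    define v where "v = (b - a) div 2"
    define u where "u = a + v"
    have bv: "b = a + 2 * v" using a b \<open>a < b\<close> by (simp add: v_def)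
    have uv: "u\<^sup>2 + v\<^sup>2 = m" using ab(1) by (simp add: bv u_def power2_eq_square algebra_simps)
    have k': "k = m - 2 * u * v"
    proof -
      have "m = a\<^sup>2 + 2 * u * v" using ab(1) by (simp add: bv u_def power2_eq_square algebra_simps)
      then show ?thesis using a by simp
    qed
    have "0 < v" "0 < u" using bv \<open>a < b\<close> by (auto simp: u_def)
    show "k \<in> (\<lambda>(x, y). m - 4 * x * y) ` two_sq_reps m"
    proof (cases "even v")
      case True
      then obtain y where "v = 2 * y" by blast
      then show ?thesis
        using uv k' \<open>0 < v\<close> \<open>0 < u\<close>
        by (intro image_eqI[of _ _ "(u, y)"]) (auto simp: two_sq_reps_def)
    next
      case False
      then have "even u" using a by (simp add: u_def)
      then obtain y where "u = 2 * y" by blast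
      then show ?thesis
        using uv k' \<open>0 < v\<close> \<open>0 < u\<close>
        by (intro image_eqI[of _ _ "(v, y)"]) (auto simp: two_sq_reps_def algebra_simps)
    qed
  next
    fix k assume "k \<in> (\<lambda>(x, y). m - 4 * x * y) ` two_sq_reps m"
    then obtain x y where xy: "k = m - 4 * x * y" "0 < x" "0 < y" "x\<^sup>2 + (2 * y)\<^sup>2 = m"
      by (auto simp: two_sq_reps_def)
    have "odd x" using xy(4) assms(1) by auto
    define w where "w = nat \<bar>int x - 2 * int y\<bar>"
    have "int (w\<^sup>2) = (int x - 2 * int y)\<^sup>2" by (simp add: w_def)
    also have "\<dots> = int (x\<^sup>2 + (2 * y)\<^sup>2) - int (4 * x * y)"
      by (simp add: power2_eq_square algebra_simps)
    finally have m: "m = w\<^sup>2 + 4 * x * y" using xy(4) by linarith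
    then have k: "k = w\<^sup>2" using xy(1) by simp
    have "odd w" using m assms(1) by auto
    then have "0 < w" by (rule odd_pos)
    have "2 * m - k = (x + 2 * y)\<^sup>2"
      using m xy(4) by (simp add: k power2_eq_square algebra_simps)
    moreover have "0 < k" "k < m" "odd k" using k m \<open>odd w\<close> \<open>0 < w\<close> xy by auto
    ultimately show "k \<in> ?B"
      using k sq_or_twice_sq_square[of w] sq_or_twice_sq_square[of "x + 2 * y"]
      by (simp add: rep_set_def)
  qed
  moreover have "inj_on (\<lambda>(x, y). m - 4 * x * y) (two_sq_reps m)"
  proof (rule inj_onI, clarify)
    fix x y x' y'
    assume "(x, y) \<in> two_sq_reps m" "(x', y') \<in> two_sq_reps m"
      and eq: "m - 4 * x * y = m - 4 * x' * y'"
    then have m: "x\<^sup>2 + (2 * y)\<^sup>2 = m" "x'\<^sup>2 + (2 * y')\<^sup>2 = m" by (auto simp: two_sq_reps_def)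
    \<comment> \<open>Ensures that the truncated subtraction \<open>m - 4 * x * y\<close> is exact,
      so that equal images give equal products.\<close>
    have le: "4 * a * b \<le> m" if "a\<^sup>2 + (2 * b)\<^sup>2 = m" for a b
    proof -
      have "0 \<le> (int a - 2 * int b)\<^sup>2" by simp
      also have "\<dots> = int (a\<^sup>2 + (2 * b)\<^sup>2) - int (4 * a * b)"
        by (simp add: power2_eq_square algebra_simps)
      finally show ?thesis using that by linarith
    qed
    have xy: "4 * x * y = 4 * x' * y'" using eq le[OF m(1)] le[OF m(2)] by linarith
    have "(x + 2 * y)\<^sup>2 = (x' + 2 * y')\<^sup>2"
      using m xy by (simp add: power2_eq_square algebra_simps)
    then have plus: "x + 2 * y = x' + 2 * y'" by (simp add: power2_eq_iff_nonneg)
    have "(int x - 2 * int y)\<^sup>2 = int (x\<^sup>2 + (2 * y)\<^sup>2) - int (4 * x * y)"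
      by (simp add: power2_eq_square algebra_simps)
    also have "\<dots> = (int x' - 2 * int y')\<^sup>2"
      unfolding m(1) xy m(2)[symmetric] by (simp add: power2_eq_square algebra_simps)
    finally have "int x - 2 * int y = int x' - 2 * int y' \<or> int x - 2 * int y = - (int x' - 2 * int y')"
      by (simp add: power2_eq_iff)
    \<comment> \<open>Excludes the negative sign: together with \<open>plus\<close> it would give
      \<open>x = 2 * y'\<close>, making \<open>m\<close> even.\<close>
    moreover have "x \<noteq> 2 * y'" using m(1) assms(1) by auto
    ultimately show "x = x' \<and> y = y'" using plus by linarith
  qed
  ultimately show ?thesis by (simp add: card_image)
qed

text \<open>Even \<open>k\<close> come from \<open>rep_set m\<close> by doubling and odd
  \<open>k\<close> from pairs of odd squares; each class contributes
  \<open>2 * card (two_sq_reps m)\<close>.\<close>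

lemma card_rep_set_double:
  assumes "m mod 8 = 5" "\<And>x. m \<noteq> x\<^sup>2"
  shows "card (rep_set (2 * m)) = 4 * card (two_sq_reps m)"
proof -
  have "odd m" using assms(1) by presburger
  have "{k \<in> rep_set (2 * m). even k} = (*) 2 ` rep_set m"
  proof (intro equalityI subsetI)
    fix k assume k: "k \<in> {k \<in> rep_set (2 * m). even k}"
    then obtain j where j: "k = 2 * j" by blast
    have "2 * m - k = 2 * (m - j)" using j by simp
    then have "j \<in> rep_set m" using k j by (simp add: rep_set_def sq_or_twice_sq_double)
    then show "k \<in> (*) 2 ` rep_set m" using j by blast
  next
    fix k assume "k \<in> (*) 2 ` rep_set m"
    then obtain j where j: "k = 2 * j" "j \<in> rep_set m" by blast
    then have "2 * m - k = 2 * (m - j)" by simp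
    then show "k \<in> {k \<in> rep_set (2 * m). even k}"
      using j by (simp add: rep_set_def sq_or_twice_sq_double)
  qed
  then have "card {k \<in> rep_set (2 * m). even k} = 2 * card (two_sq_reps m)"
    by (simp add: card_image inj_on_def card_rep_set_odd[OF assms(1)])
  moreover have "card (rep_set (2 * m))
      = card {k \<in> rep_set (2 * m). even k} + card {k \<in> rep_set (2 * m). odd k}"
    by (subst card_Un_disjoint[symmetric]) (auto simp: finite_rep_set intro: arg_cong[where f = card])
  ultimately show ?thesis
    using card_odd_rep_set_double[OF \<open>odd m\<close> assms(2)] by simp
qed

lemma card_rep_set_power2:
  assumes "m mod 8 = 5" "\<And>x. m \<noteq> x\<^sup>2"
  shows "card (rep_set (2 ^ Suc a * m)) = 4 * card (two_sq_reps m)"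
proof (induction a)
  case 0
  then show ?case using card_rep_set_double[OF assms] by simp
next
  case (Suc a)
  then show ?case using card_rep_set_4[of "2 ^ a * m"] by (simp add: mult.assoc)
qed

section \<open>The convolution of odd-divisor counts modulo 4\<close>

text \<open>Pairing \<open>k\<close> with \<open>n - k\<close> doubles an even value; only a middle
  term has no partner.\<close>

lemma four_dvd_symmetric_sum:
  fixes h :: "nat \<Rightarrow> int"
  assumes sym: "\<And>k. 0 < k \<Longrightarrow> k < n \<Longrightarrow> h (n - k) = h k"
    and even: "\<And>k. 0 < k \<Longrightarrow> k < n \<Longrightarrow> even (h k)"
    and mid: "\<And>k. 0 < k \<Longrightarrow> 2 * k = n \<Longrightarrow> 4 dvd h k"
  shows "4 dvd (\<Sum>k\<in>{0<..<n}. h k)"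
proof -
  let ?L = "{k \<in> {0<..<n}. 2 * k < n}"
  let ?M = "{k \<in> {0<..<n}. 2 * k = n}"
  let ?R = "{k \<in> {0<..<n}. n < 2 * k}"
  have "sum h {0<..<n} = sum h ((?L \<union> ?R) \<union> ?M)"
    by (rule sum.cong) auto
  moreover have "sum h ((?L \<union> ?R) \<union> ?M) = sum h (?L \<union> ?R) + sum h ?M"
    by (rule sum.union_disjoint) auto
  moreover have "sum h (?L \<union> ?R) = sum h ?L + sum h ?R"
    by (rule sum.union_disjoint) auto
  moreover have "sum h ?R = sum h ?L"
  proof (rule sum.reindex_bij_witness[of _ "\<lambda>k. n - k" "\<lambda>k. n - k"])
    show "h (n - k) = h k" if "k \<in> ?R" for k using that by (intro sym) simp_all
  qed (simp_all, linarith+)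
  ultimately have "sum h {0<..<n} = 2 * sum h ?L + sum h ?M" by linarith
  moreover have "4 dvd 2 * sum h ?L"
  proof -
    have "even (sum h ?L)" using even by (intro dvd_sum) simp
    then obtain c where "sum h ?L = 2 * c" by (rule evenE)
    then show ?thesis by simp
  qed
  moreover have "4 dvd sum h ?M" using mid by (intro dvd_sum) simp
  ultimately show ?thesis by (simp only: dvd_add)
qed

text \<open>The indicator of \<open>rep_set n\<close> has the parity of the product of the two
  counts, and symmetry lifts this agreement from modulo 2 to modulo 4. At the midpoint the even
  count makes the square divisible by 4 and the indicator 0.\<close>

lemma sum_odd_divisors_mod_4:
  assumes "0 < n" "\<And>k. 2 * k = n \<Longrightarrow> even (card (odd_divisors k))"
  shows "[(\<Sum>k\<in>{0<..<n}. int (card (odd_divisors k)) * int (card (odd_divisors (n - k))))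
           = int (card (rep_set n))] (mod 4)"
proof -
  let ?t = "\<lambda>k. int (card (odd_divisors k))"
  let ?b = "\<lambda>k. of_bool (sq_or_twice_sq k \<and> sq_or_twice_sq (n - k)) :: int"
  have "(\<Sum>k\<in>{0<..<n}. ?b k) = int (card (rep_set n))"
    by (simp add: rep_set_def of_bool_def sum.If_cases Int_def)
  moreover have "4 dvd (\<Sum>k\<in>{0<..<n}. ?t k * ?t (n - k) - ?b k)"
  proof (rule four_dvd_symmetric_sum)
    fix k assume "0 < k" "k < n"
    then show "even (?t k * ?t (n - k) - ?b k)"
      using odd_card_odd_divisors[of k] odd_card_odd_divisors[of "n - k"] by auto
    show "?t (n - k) * ?t (n - (n - k)) - ?b (n - k) = ?t k * ?t (n - k) - ?b k"
      using \<open>k < n\<close> by (simp add: mult.commute conj_commute)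
  next
    fix k assume k: "0 < k" "2 * k = n"
    then have e: "even (card (odd_divisors k))" using assms(2) by blast
    then have "\<not> sq_or_twice_sq k" using odd_card_odd_divisors[OF k(1)] by blast
    moreover have "n - k = k" using k by simp
    moreover obtain c where "?t k = 2 * c" using e by (metis even_of_nat evenE)
    ultimately show "4 dvd ?t k * ?t (n - k) - ?b k" by simp
  qed
  ultimately show ?thesis by (simp add: sum_subtractf cong_iff_dvd_diff)
qed

section \<open>The congruence\<close>

lemma square_mod_8_neq_5: "m mod 8 = 5 \<Longrightarrow> m \<noteq> (x :: nat)\<^sup>2"
proof
  assume m: "m mod 8 = 5" "m = x\<^sup>2"
  show False
  proof (cases "even x")
    case True
    then have "even m" using m(2) by simp
    with m(1) show False by presburger
  next
    case False
    then show False using m odd_square_mod_8[of x] by simp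
  qed
qed

lemma card_divisors_nonsquare:
  assumes "0 < m" "\<And>x. m \<noteq> x\<^sup>2"
  shows "card {d. d dvd m} = 2 * card (small_divisors m)"
  using sum_divisors_pair[OF assms, of "\<lambda>_. 1"] by simp

text \<open>Cofactors have product 1 modulo 4, so both are 1 or both are 3 and each pair sums to 2
  modulo 4.\<close>

lemma sum_divisors_mod_4:
  assumes "m mod 8 = 5"
  shows "[(\<Sum>d | d dvd m. int (m div d)) = 2 * int (card (small_divisors m))] (mod 4)"
proof -
  have "0 < m" using assms by (cases m) auto
  have "[int (m div d) + int (m div (m div d)) = 2] (mod 4)" if d: "d \<in> small_divisors m" for d
  proof -
    obtain e where e: "m = d * e" using d by (auto simp: small_divisors_def)
    have "m mod 4 = 1" using assms by presburger
    then have "(d + e) mod 4 = 2" using mod_4_eq_of_mult(2)[of d e] e by simp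
    moreover have "m div d = e" "m div e = d" using e \<open>0 < m\<close> by auto
    ultimately have "int ((m div d + m div (m div d)) mod 4) = 2" by (simp add: add.commute)
    then show ?thesis by (simp add: cong_def zmod_int)
  qed
  then have "[(\<Sum>d\<in>small_divisors m. int (m div d) + int (m div (m div d)))
      = (\<Sum>d\<in>small_divisors m. 2)] (mod 4)"
    by (rule cong_sum)
  then show ?thesis
    using sum_divisors_pair[OF \<open>0 < m\<close> square_mod_8_neq_5[OF assms], of "\<lambda>d. int (m div d)"]
    by (simp add: mult.commute)
qed

theorem theorem2p2:
  fixes n \<alpha> :: nat
  shows "[OPT (2 ^ \<alpha> * (8 * n + 5)) = 0] (mod 8)"
proof -
  define m where "m = 8 * n + 5"
  define N where "N = 2 ^ \<alpha> * m"
  define h where "h = int (card (small_divisors m))"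
  define \<sigma> where "\<sigma> = (\<Sum>d | d dvd m. int (m div d))"
  have m8: "m mod 8 = 5" and "odd m" "0 < m" by (simp_all add: m_def)
  note nonsq = square_mod_8_neq_5[OF m8]
  have "0 < N" using \<open>0 < m\<close> by (simp add: N_def)
  have div_N: "odd_divisors N = {d. d dvd m}"
    using \<open>odd m\<close> by (simp add: N_def odd_divisors_power2_times odd_divisors_odd)
  have card_N: "int (card (odd_divisors N)) = 2 * h"
    using card_divisors_nonsquare[OF \<open>0 < m\<close> nonsq] by (simp add: div_N h_def)
  have "(\<Sum>d\<in>odd_divisors N. int (N div d) - 1) = (\<Sum>d\<in>odd_divisors N. int (N div d)) - 2 * h"
    by (simp add: sum_subtractf card_N)
  also have "(\<Sum>d\<in>odd_divisors N. int (N div d)) = 2 ^ \<alpha> * \<sigma>"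
    unfolding div_N \<sigma>_def sum_distrib_left
    by (rule sum.cong) (simp_all add: N_def div_mult_swap[symmetric])
  finally have E: "(\<Sum>d\<in>odd_divisors N. int (N div d) - 1) = 2 ^ \<alpha> * \<sigma> - 2 * h" .
  \<comment> \<open>The midpoint condition of \<open>sum_odd_divisors_mod_4\<close>:
    \<open>N\<close> and its half have the same odd divisors, \<open>2 * h\<close> in
    number.\<close>
  have "even (card (odd_divisors k))" if "2 * k = N" for k
  proof -
    have "odd_divisors k = odd_divisors N" using that odd_divisors_double by blast
    then show ?thesis using card_N by (metis dvd_triv_left even_of_nat)
  qed
  then obtain a where a: "(\<Sum>k\<in>{0<..<N}. int (card (odd_divisors k)) * int (card (odd_divisors (N - k))))
      = int (card (rep_set N)) + 4 * a"
    using sum_odd_divisors_mod_4[OF \<open>0 < N\<close>] by (metis cong_iff_lin cong_sym)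
  obtain b where b: "\<sigma> = 2 * h + 4 * b"
    using sum_divisors_mod_4[OF m8] by (metis cong_iff_lin cong_sym \<sigma>_def h_def)
  have "[int (OPT N) = 12 * h + 2 * (int (card (rep_set N)) + 4 * a) + 2 * (2 ^ \<alpha> * \<sigma> - 2 * h)] (mod 8)"
    using OPT_mod_8[OF \<open>0 < N\<close>] unfolding card_N E a by simp
  moreover have "8 dvd 12 * h + 2 * (int (card (rep_set N)) + 4 * a) + 2 * (2 ^ \<alpha> * \<sigma> - 2 * h)"
  proof (cases \<alpha>)
    \<comment> \<open>With \<open>N = m\<close>, what remains modulo 8 is
      \<open>12 * h + 4 * card (two_sq_reps m)\<close>; this vanishes because the Zagier argument
      gives \<open>h\<close> and \<open>card (two_sq_reps m)\<close> the same parity.\<close>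
    case 0
    have "m mod 4 = 1" using m8 by presburger
    then have "even (int (card (two_sq_reps m)) + h)"
      using even_card_two_sq_reps[OF _ nonsq] by (simp add: h_def)
    then obtain c where "int (card (two_sq_reps m)) = 2 * c - h"
      by (metis evenE add_diff_cancel_right')
    moreover have "int (card (rep_set N)) = 2 * int (card (two_sq_reps m))"
      using 0 card_rep_set_odd[OF m8] by (simp add: N_def)
    ultimately have "12 * h + 2 * (int (card (rep_set N)) + 4 * a) + 2 * (2 ^ \<alpha> * \<sigma> - 2 * h)
        = 8 * (h + c + a + b)"
      unfolding b by (simp add: 0 algebra_simps)
    then show ?thesis by (simp only: dvd_triv_left)
  next
    \<comment> \<open>Now \<open>card (rep_set N)\<close> is a multiple of 4, and the factor 2 in
      \<open>2 ^ \<alpha>\<close> together with the evenness of \<open>\<sigma>\<close> makes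
      \<open>2 * 2 ^ \<alpha> * \<sigma>\<close> a multiple of 8; the remaining
      \<open>12 * h - 4 * h\<close> is \<open>8 * h\<close>.\<close>
    case (Suc \<beta>)
    have "int (card (rep_set N)) = 4 * int (card (two_sq_reps m))"
      using Suc card_rep_set_power2[OF m8 nonsq, of \<beta>] by (simp add: N_def)
    then have "12 * h + 2 * (int (card (rep_set N)) + 4 * a) + 2 * (2 ^ \<alpha> * \<sigma> - 2 * h)
        = 8 * (h + int (card (two_sq_reps m)) + a + 2 ^ \<beta> * (h + 2 * b))"
      unfolding b by (simp add: Suc algebra_simps)
    then show ?thesis by (simp only: dvd_triv_left)
  qed
  ultimately have "8 dvd int (OPT N)" by (simp add: cong_dvd_iff)
  then show ?thesis
    by (simp add: N_def m_def cong_0_iff) (metis int_dvd_int_iff of_nat_numeral)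
qed

end
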